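(* Let $\varphi:X\to\mathbb{R}$ be a Lipschitz function, and define $\tilde H_\varphi(\underline{x})=H_\varphi(\underline{x},\underline{x})$ for $\underline{x}\in X$. Then $$\Omega_\varphi=\tilde H_\varphi^{-1}(\{0\})=A_\varphi .$$
   Context: $\mathbb{N}_0$ is the set of non-negative integers and $X=[0,1]^{\mathbb{N}_0}$ with metric $d(\underline{x},\underline{y})=\sum_{i\ge 0}|x_i-y_i|/2^i$; $\sigma:X\to X$ is the left shift, $(\sigma(\underline{x}))_i=x_{i+1}$. For a function $\psi:X\to\mathbb{R}$ and $n\in\mathbb{N}=\{1,2,\dots\}$, $S_n\psi=\sum_{i=0}^{n-1}\psi\circ\sigma^i$. For continuous $\varphi:X\to\mathbb{R}$, $\alpha_\varphi=\inf_\mu\int\varphi\,d\mu$, the infimum being over all $\sigma$-invariant Borel probability measures $\mu$ on $X$. For $\underline{x},\underline{y}\in X$, $n\in\mathbb{N}$, $\varepsilon>0$ let $B(\underline{x},\underline{y},n;\varepsilon)=\{\underline{z}\in X: d(\underline{x},\underline{z})<\varepsilon,\ d(\sigma^n(\underline{z}),\underline{y})<\varepsilon\}$. Mañé potential: $S_\varphi(\underline{x},\underline{y})=\lim_{\varepsilon\to0}\inf\{S_n(\varphi-\alpha_\varphi)(\underline{z}): n\in\mathbb{N},\ \underline{z}\in B(\underline{x},\underline{y},n;\varepsilon)\}$. Peierl's barrier: $H_\varphi(\underline{x},\underline{y})=\lim_{\varepsilon\to0}\liminf_{n\to\infty}\inf\{S_n(\varphi-\alpha_\varphi)(\underline{z}):\underline{z}\in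 B(\underline{x},\underline{y},n;\varepsilon)\}$, with $\inf\emptyset=+\infty$. Both functions may take the value $+\infty$. Aubry set: $\Omega_\varphi=\{\underline{x}\in X: S_\varphi(\underline{x},\underline{x})=0\}$. A positive semi-orbit $\{\sigma^n(\underline{x})\}_{n\in\mathbb{N}_0}$ is called $\varphi$-static if for all non-negative integers $i<j$, $\sum_{n=i}^{j-1}(\varphi(\sigma^n(\underline{x}))-\alpha_\varphi)=-S_\varphi(\sigma^j(\underline{x}),\sigma^i(\underline{x}))$. The $\varphi$-static set is $A_\varphi=\{\sigma^k(\underline{x}): \underline{x}\in X,\ \{\sigma^n(\underline{x})\}_{n\in\mathbb{N}_0}\text{ is }\varphi\text{-static},\ k\in\mathbb{N}_0\}$. *)

theory Defs
  imports "HOL-Probability.Probability"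
begin

typedef seqs = "{x :: nat \<Rightarrow> real. \<forall>i. x i \<in> {0..1}}"
  morphisms coord Seq
  by (rule exI[of _ "\<lambda>_. 0"]) simp

lemma coord_bounds: "0 \<le> coord x i" "coord x i \<le> 1"
  using coord[of x] by auto

lemma summable_seqs_dist: "summable (\<lambda>i. \<bar>coord x i - coord y i\<bar> / 2 ^ i)"
proof (rule summable_comparison_test')
  show "summable (\<lambda>i. (1 / 2 :: real) ^ i)"
    by (rule summable_geometric) simp
  fix i :: nat
  have "\<bar>coord x i - coord y i\<bar> \<le> 1"
    using coord_bounds[of x i] coord_bounds[of y i] by linarith
  then show "norm (\<bar>coord x i - coord y i\<bar> / 2 ^ i) \<le> (1 / 2) ^ i"
    by (simp add: power_divide divide_right_mono)
qed

instantiation seqs :: metric_space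
begin

definition dist_seqs :: "seqs \<Rightarrow> seqs \<Rightarrow> real" where
  "dist_seqs x y = (\<Sum>i. \<bar>coord x i - coord y i\<bar> / 2 ^ i)"

definition uniformity_seqs :: "(seqs \<times> seqs) filter" where
  "uniformity_seqs = (INF e\<in>{0<..}. principal {(x, y). dist x y < e})"

definition open_seqs :: "seqs set \<Rightarrow> bool" where
  "open_seqs U \<longleftrightarrow> (\<forall>x\<in>U. \<forall>\<^sub>F (x', y) in uniformity. x' = x \<longrightarrow> y \<in> U)"

instance
proof
  fix x y z :: seqs
  show "dist x y = 0 \<longleftrightarrow> x = y"
    unfolding dist_seqs_def
    by (subst suminf_eq_zero_iff[OF summable_seqs_dist])
       (auto simp: coord_inject[symmetric] fun_eq_iff)
  have "dist x y \<le> (\<Sum>i. \<bar>coord x i - coord z i\<bar> / 2 ^ i + \<bar>coord y i - coord z i\<bar> / 2 ^ i)"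
    unfolding dist_seqs_def
    by (intro suminf_le summable_seqs_dist summable_add)
       (simp add: add_divide_distrib[symmetric] divide_right_mono)
  also have "\<dots> = dist x z + dist y z"
    unfolding dist_seqs_def by (rule suminf_add[symmetric]) (rule summable_seqs_dist)+
  finally show "dist x y \<le> dist x z + dist y z" .
qed (rule uniformity_seqs_def open_seqs_def)+

end

definition shift :: "seqs \<Rightarrow> seqs" where
  "shift x = Seq (\<lambda>i. coord x (Suc i))"

lemma coord_shift [simp]: "coord (shift x) i = coord x (Suc i)"
  using coord_bounds by (simp add: shift_def Seq_inverse)

definition birkhoff_sum :: "nat \<Rightarrow> (seqs \<Rightarrow> real) \<Rightarrow> seqs \<Rightarrow> real" where
  "birkhoff_sum n \<psi> x = (\<Sum>i<n. \<psi> ((shift ^^ i) x))"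

definition invariant_measures :: "seqs measure set" where
  "invariant_measures =
     {\<mu>. prob_space \<mu> \<and> sets \<mu> = sets borel \<and>
         (\<forall>A\<in>sets borel. emeasure \<mu> (shift -` A) = emeasure \<mu> A)}"

definition min_value :: "(seqs \<Rightarrow> real) \<Rightarrow> real" where
  "min_value \<phi> = (INF \<mu>\<in>invariant_measures. \<integral>x. \<phi> x \<partial>\<mu>)"

definition connecting :: "seqs \<Rightarrow> seqs \<Rightarrow> nat \<Rightarrow> real \<Rightarrow> seqs set" where
  "connecting x y n \<epsilon> = {z. dist x z < \<epsilon> \<and> dist ((shift ^^ n) z) y < \<epsilon>}"

text \<open>The limits below are taken in the extended reals; they exist by monotonicity in
  \<open>\<epsilon>\<close>, see \<open>tendsto_mane_potential\<close> and \<open>tendsto_peierls_barrier\<close>.\<close>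

definition mane_potential :: "(seqs \<Rightarrow> real) \<Rightarrow> seqs \<Rightarrow> seqs \<Rightarrow> ereal" where
  "mane_potential \<phi> x y =
     Lim (at_right 0) (\<lambda>\<epsilon>.
       Inf {ereal (birkhoff_sum n (\<lambda>w. \<phi> w - min_value \<phi>) z) | n z.
              1 \<le> n \<and> z \<in> connecting x y n \<epsilon>})"

definition peierls_barrier :: "(seqs \<Rightarrow> real) \<Rightarrow> seqs \<Rightarrow> seqs \<Rightarrow> ereal" where
  "peierls_barrier \<phi> x y =
     Lim (at_right 0) (\<lambda>\<epsilon>.
       liminf (\<lambda>n. INF z\<in>connecting x y n \<epsilon>.
         ereal (birkhoff_sum n (\<lambda>w. \<phi> w - min_value \<phi>) z)))"

lemma connecting_mono: "\<delta> \<le> \<epsilon> \<Longrightarrow> connecting x y n \<delta> \<subseteq> connecting x y n \<epsilon>"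
  by (auto simp: connecting_def)

lemma antimono_tendsto_Lim_at_right:
  fixes f :: "real \<Rightarrow> ereal"
  assumes "\<And>\<delta> \<epsilon>. \<delta> \<le> \<epsilon> \<Longrightarrow> f \<epsilon> \<le> f \<delta>"
  shows "(f \<longlongrightarrow> Lim (at_right 0) f) (at_right 0)"
proof -
  have "(f \<longlongrightarrow> (SUP \<epsilon>\<in>{0<..}. f \<epsilon>)) (at_right 0)"
  proof (rule increasing_tendsto)
    show "\<forall>\<^sub>F \<epsilon> in at_right 0. f \<epsilon> \<le> (SUP \<epsilon>\<in>{0<..}. f \<epsilon>)"
      by (rule eventually_at_right_less[THEN eventually_mono]) (auto intro: SUP_upper)
  next
    fix c assume "c < (SUP \<epsilon>\<in>{0<..}. f \<epsilon>)"
    then obtain e where e: "0 < e" "c < f e"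
      by (auto simp: less_SUP_iff)
    show "\<forall>\<^sub>F \<epsilon> in at_right 0. c < f \<epsilon>"
      unfolding eventually_at_right_field
      using e assms by (meson less_imp_le less_le_trans)
  qed
  then show ?thesis
    by (simp add: tendsto_Lim)
qed

lemma tendsto_mane_potential:
  "((\<lambda>\<epsilon>. Inf {ereal (birkhoff_sum n (\<lambda>w. \<phi> w - min_value \<phi>) z) | n z.
              1 \<le> n \<and> z \<in> connecting x y n \<epsilon>}) \<longlongrightarrow> mane_potential \<phi> x y) (at_right 0)"
  unfolding mane_potential_def
  by (rule antimono_tendsto_Lim_at_right, rule Inf_superset_mono) (use connecting_mono in blast)

lemma tendsto_peierls_barrier:
  "((\<lambda>\<epsilon>. liminf (\<lambda>n. INF z\<in>connecting x y n \<epsilon>.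
         ereal (birkhoff_sum n (\<lambda>w. \<phi> w - min_value \<phi>) z))) \<longlongrightarrow> peierls_barrier \<phi> x y)
     (at_right 0)"
  unfolding peierls_barrier_def
  by (rule antimono_tendsto_Lim_at_right, intro Liminf_mono always_eventually allI
        INF_superset_mono connecting_mono) auto

definition aubry_set :: "(seqs \<Rightarrow> real) \<Rightarrow> seqs set" where
  "aubry_set \<phi> = {x. mane_potential \<phi> x x = 0}"

definition static_orbit :: "(seqs \<Rightarrow> real) \<Rightarrow> seqs \<Rightarrow> bool" where
  "static_orbit \<phi> x \<longleftrightarrow>
     (\<forall>i j. i < j \<longrightarrow>
        ereal (\<Sum>n = i..<j. \<phi> ((shift ^^ n) x) - min_value \<phi>) =
        - mane_potential \<phi> ((shift ^^ j) x) ((shift ^^ i) x))"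

definition static_set :: "(seqs \<Rightarrow> real) \<Rightarrow> seqs set" where
  "static_set \<phi> = {(shift ^^ k) x | k x. static_orbit \<phi> x}"

end

theory Submission
  imports Defs
begin

text \<open>
  Write \<open>S\<^sub>n\<close> for the Birkhoff sums of \<open>\<phi> - min_value \<phi>\<close> and call a point \<open>z\<close> with \<open>z\<close> and
  \<open>\<sigma>\<^sup>n z\<close> both close to \<open>x\<close> an almost-loop at \<open>x\<close> of length \<open>n\<close> and cost \<open>S\<^sub>n z\<close>. Everything rests
  on two features of the full shift. Words may be concatenated freely, and two points that agree on
  their first \<open>n\<close> coordinates have exponentially close orbits up to time \<open>n\<close>, so that for an
  \<open>L\<close>-Lipschitz function their Birkhoff sums up to time \<open>n\<close> differ by at most \<open>L\<close> times the distance
  of the two endpoints, whatever \<open>n\<close> is (\<open>birkhoff_sum_agree\<close>).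

  An almost-loop can therefore be replaced, at small cost, by the periodic point that repeats its
  first \<open>n\<close> coordinates (\<open>closing\<close>). The uniform measure on a periodic orbit is invariant, so the
  cost of a genuine loop is nonnegative by definition of \<open>min_value \<phi>\<close>
  (\<open>birkhoff_sum_periodic_nonneg\<close>); hence the cost of almost-loops cannot be substantially
  negative (\<open>cost_almost_loop_ge\<close>).

  Suppose that \<open>mane_potential \<phi> x x = 0\<close>. A very cheap almost-loop is closed up and run
  through \<open>N\<close> times, which gives cheap almost-loops of length at least \<open>N\<close>, so the barrier vanishes
  too (\<open>peierls_barrier_zero_if_mane_potential_zero\<close>).

  Suppose that the barrier vanishes at \<open>x\<close>. Then there are cheap almost-loops at \<open>x\<close> longer than
  any given \<open>j\<close>. Cutting off the first \<open>j\<close> steps and continuing for another \<open>i < j\<close> steps beyond the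
  end yields an orbit segment from near \<open>\<sigma>\<^sup>j x\<close> to near \<open>\<sigma>\<^sup>i x\<close>, of cost close to
  \<open>- S\<^bsub>j - i\<^esub> (\<sigma>\<^sup>i x)\<close> (\<open>mane_potential_return_le\<close>). In the limit no segment is cheaper, since
  prepending the word \<open>x\<^sub>i \<dots> x\<^bsub>j - 1\<^esub>\<close> to it gives an almost-loop at \<open>\<sigma>\<^sup>i x\<close>
  (\<open>mane_potential_return_ge\<close>). So the orbit of \<open>x\<close> is static.

  Suppose finally that \<open>x\<close> lies on a static orbit. The static condition for the single step from
  \<open>x\<close> to \<open>\<sigma> x\<close> provides segments from near \<open>\<sigma> x\<close> to near \<open>x\<close> of cost close to \<open>- S\<^sub>1 x\<close>, and
  prepending \<open>x\<^sub>0\<close> makes them almost-loops at \<open>x\<close> of cost close to \<open>0\<close>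
  (\<open>mane_potential_zero_on_static_orbit\<close>). This closes the cycle of inclusions.
\<close>

section \<open>Metric estimates for the full shift\<close>

lemma coord_shift_funpow: "coord ((shift ^^ n) x) i = coord x (i + n)"
  by (induction n arbitrary: i) auto

lemma seqs_eqI: "(\<And>i. coord x i = coord y i) \<Longrightarrow> x = y"
  by (simp add: coord_inject[symmetric] fun_eq_iff)

lemma coord_Seq: "(\<And>i. 0 \<le> f i \<and> f i \<le> 1) \<Longrightarrow> coord (Seq f) = f"
  by (rule Seq_inverse) simp

lemma dist_shift_split:
  "dist x y = (\<Sum>i<n. \<bar>coord x i - coord y i\<bar> / 2 ^ i) +
     dist ((shift ^^ n) x) ((shift ^^ n) y) / 2 ^ n"
proof -
  have "dist x y = (\<Sum>i. \<bar>coord x (i + n) - coord y (i + n)\<bar> / 2 ^ (i + n))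
      + (\<Sum>i<n. \<bar>coord x i - coord y i\<bar> / 2 ^ i)"
    unfolding dist_seqs_def by (rule suminf_split_initial_segment[OF summable_seqs_dist])
  also have "(\<Sum>i. \<bar>coord x (i + n) - coord y (i + n)\<bar> / 2 ^ (i + n))
      = (\<Sum>i. \<bar>coord ((shift ^^ n) x) i - coord ((shift ^^ n) y) i\<bar> / 2 ^ i / 2 ^ n)"
    by (simp add: coord_shift_funpow power_add)
  also have "\<dots> = dist ((shift ^^ n) x) ((shift ^^ n) y) / 2 ^ n"
    unfolding dist_seqs_def by (rule suminf_divide[OF summable_seqs_dist])
  finally show ?thesis by simp
qed

lemma dist_agree:
  assumes "\<And>i. i < n \<Longrightarrow> coord x i = coord y i"
  shows "dist x y = dist ((shift ^^ n) x) ((shift ^^ n) y) / 2 ^ n"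
  using assms by (subst dist_shift_split[of _ _ n]) simp

lemma dist_shift_funpow_le: "dist ((shift ^^ n) x) ((shift ^^ n) y) \<le> 2 ^ n * dist x y"
proof -
  have "0 \<le> (\<Sum>i<n. \<bar>coord x i - coord y i\<bar> / 2 ^ i)"
    by (intro sum_nonneg) simp
  then have "dist ((shift ^^ n) x) ((shift ^^ n) y) / 2 ^ n \<le> dist x y"
    using dist_shift_split[of x y n] by linarith
  then show ?thesis by (simp add: field_simps)
qed

lemma dist_seqs_le_2: "dist (x :: seqs) y \<le> 2"
proof -
  have "dist x y \<le> (\<Sum>i. (1 / 2 :: real) ^ i)"
    unfolding dist_seqs_def
  proof (intro suminf_le summable_seqs_dist summable_geometric)
    fix i :: nat
    have "\<bar>coord x i - coord y i\<bar> \<le> 1"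
      using coord_bounds[of x i] coord_bounds[of y i] by linarith
    then show "\<bar>coord x i - coord y i\<bar> / 2 ^ i \<le> (1 / 2) ^ i"
      by (simp add: power_divide divide_right_mono)
  qed simp
  also have "\<dots> = 2" by (subst suminf_geometric) auto
  finally show ?thesis .
qed

lemma shift_measurable: "shift \<in> borel_measurable borel"
proof (intro borel_measurable_continuous_onI lipschitz_on_continuous_on)
  show "2-lipschitz_on UNIV shift"
    using dist_shift_funpow_le[of 1] by (intro lipschitz_onI) auto
qed

definition prepend :: "nat \<Rightarrow> seqs \<Rightarrow> seqs \<Rightarrow> seqs" where
  "prepend n x y = Seq (\<lambda>i. if i < n then coord x i else coord y (i - n))"

lemma coord_prepend: "coord (prepend n x y) i = (if i < n then coord x i else coord y (i - n))"
  unfolding prepend_def by (subst coord_Seq) (auto simp: coord_bounds)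

lemma shift_prepend: "(shift ^^ n) (prepend n x y) = y"
  by (rule seqs_eqI) (simp add: coord_shift_funpow coord_prepend)

section \<open>Birkhoff sums\<close>

lemma birkhoff_sum_add:
  "birkhoff_sum (m + n) \<psi> x = birkhoff_sum m \<psi> x + birkhoff_sum n \<psi> ((shift ^^ m) x)"
proof -
  have "(\<Sum>i<m + n. \<psi> ((shift ^^ i) x)) =
      (\<Sum>i<m. \<psi> ((shift ^^ i) x)) + (\<Sum>i<n. \<psi> ((shift ^^ (m + i)) x))"
    by (induction n) (simp_all add: add.assoc)
  then show ?thesis
    unfolding birkhoff_sum_def by (simp add: add.commute[of m] funpow_add)
qed

lemma birkhoff_sum_1 [simp]: "birkhoff_sum (Suc 0) \<psi> x = \<psi> x"
  by (simp add: birkhoff_sum_def)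

lemma birkhoff_sum_periodic:
  assumes "(shift ^^ n) p = p"
  shows "(shift ^^ (k * n)) p = p \<and> birkhoff_sum (k * n) \<psi> p = real k * birkhoff_sum n \<psi> p"
proof (induction k)
  case (Suc k)
  then show ?case
    using assms by (simp add: birkhoff_sum_add funpow_add algebra_simps)
qed (simp add: birkhoff_sum_def)

text \<open>The distance of the orbits at time \<open>k \<le> n\<close> is \<open>2 ^ (n - k)\<close> times smaller than at time
  \<open>n\<close>, so the errors sum up to a geometric series. The sharper factor in the induction is its partial
  sum.\<close>

lemma birkhoff_sum_agree:
  assumes L: "L-lipschitz_on UNIV \<psi>"
    and agree: "\<And>i. i < n \<Longrightarrow> coord x i = coord y i"
  shows "\<bar>birkhoff_sum n \<psi> x - birkhoff_sum n \<psi> y\<bar> \<le> L * dist ((shift ^^ n) x) ((shift ^^ n) y)"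
proof -
  let ?D = "\<lambda>n x y. dist ((shift ^^ n) x) ((shift ^^ n) y)"
  have "\<bar>birkhoff_sum n \<psi> x - birkhoff_sum n \<psi> y\<bar> \<le> L * ((1 - 1 / 2 ^ n) * ?D n x y)"
    using agree
  proof (induction n arbitrary: x y)
    case (Suc n)
    have "\<bar>\<psi> x - \<psi> y\<bar> \<le> L * dist x y"
      using lipschitz_onD[OF L, of x y] by (simp add: dist_real_def)
    also have "dist x y = ?D (Suc n) x y / 2 ^ Suc n"
      by (rule dist_agree) (rule Suc.prems)
    finally have "\<bar>\<psi> x - \<psi> y\<bar> \<le> L * (?D (Suc n) x y / 2 ^ Suc n)" .
    moreover have "\<bar>birkhoff_sum n \<psi> (shift x) - birkhoff_sum n \<psi> (shift y)\<bar>
        \<le> L * ((1 - 1 / 2 ^ n) * ?D n (shift x) (shift y))"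
      by (rule Suc.IH) (simp add: Suc.prems)
    moreover have "birkhoff_sum (Suc n) \<psi> u = \<psi> u + birkhoff_sum n \<psi> (shift u)" for u
      using birkhoff_sum_add[of 1 n \<psi> u] by simp
    moreover have "?D n (shift x) (shift y) = ?D (Suc n) x y"
      by (simp add: funpow_swap1)
    ultimately have "\<bar>birkhoff_sum (Suc n) \<psi> x - birkhoff_sum (Suc n) \<psi> y\<bar>
        \<le> L * (?D (Suc n) x y / 2 ^ Suc n) + L * ((1 - 1 / 2 ^ n) * ?D (Suc n) x y)"
      by simp
    also have "\<dots> = L * ((1 - 1 / 2 ^ Suc n) * ?D (Suc n) x y)"
      by (simp add: field_simps)
    finally show ?case .
  qed (simp add: birkhoff_sum_def)
  also have "\<dots> \<le> L * ?D n x y"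
    using lipschitz_on_nonneg[OF L] by (intro mult_left_mono mult_left_le_one_le) auto
  finally show ?thesis .
qed

text \<open>The constant grows exponentially in \<open>n\<close>; the bound serves for initial pieces of fixed length,
  while \<open>x\<close> and \<open>y\<close> need not share any coordinate.\<close>

lemma birkhoff_sum_lipschitz:
  assumes L: "L-lipschitz_on UNIV \<psi>"
  shows "\<bar>birkhoff_sum n \<psi> x - birkhoff_sum n \<psi> y\<bar> \<le> L * 2 ^ n * dist x y"
proof (induction n)
  case (Suc n)
  have "\<bar>\<psi> ((shift ^^ n) x) - \<psi> ((shift ^^ n) y)\<bar> \<le> L * dist ((shift ^^ n) x) ((shift ^^ n) y)"
    using lipschitz_onD[OF L] by (simp add: dist_real_def)
  also have "\<dots> \<le> L * (2 ^ n * dist x y)"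
    by (rule mult_left_mono[OF dist_shift_funpow_le lipschitz_on_nonneg[OF L]])
  finally show ?case
    using Suc by (simp add: birkhoff_sum_def)
qed (simp add: birkhoff_sum_def lipschitz_on_nonneg[OF L])

text \<open>With \<open>p\<close> the periodic repetition of the first \<open>n\<close> coordinates of \<open>z\<close>, the distance \<open>D\<close> of \<open>p\<close>
  to \<open>\<sigma>\<^sup>n z\<close> satisfies \<open>D \<le> dist p z + 2\<epsilon>\<close>, and \<open>dist p z = D / 2 ^ n \<le> D / 2\<close>; hence \<open>D \<le> 4\<epsilon>\<close>.\<close>

lemma closing:
  assumes L: "L-lipschitz_on UNIV \<psi>" and n: "1 \<le> n" and z: "z \<in> connecting x x n \<epsilon>"
  obtains p where "(shift ^^ n) p = p" "dist x p < 3 * \<epsilon>"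
    "\<bar>birkhoff_sum n \<psi> p - birkhoff_sum n \<psi> z\<bar> \<le> 4 * L * \<epsilon>"
proof -
  define p where "p = Seq (\<lambda>i. coord z (i mod n))"
  have coord_p: "coord p i = coord z (i mod n)" for i
    unfolding p_def by (subst coord_Seq) (auto simp: coord_bounds)
  have per: "(shift ^^ n) p = p"
    by (rule seqs_eqI) (simp add: coord_shift_funpow coord_p)
  have agree: "coord p i = coord z i" if "i < n" for i
    using that by (simp add: coord_p)
  define D where "D = dist p ((shift ^^ n) z)"
  have pz: "dist p z = D / 2 ^ n"
    using dist_agree[of n p z] agree per by (simp add: D_def)
  have "(2 :: real) ^ 1 \<le> 2 ^ n"
    by (rule power_increasing) (use n in auto)
  then have half: "dist p z \<le> D / 2"
    unfolding pz by (intro divide_left_mono) (auto simp: D_def)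
  have close: "dist x z < \<epsilon>" "dist ((shift ^^ n) z) x < \<epsilon>"
    using z by (auto simp: connecting_def)
  have "D \<le> dist p z + dist x z + dist ((shift ^^ n) z) x"
    unfolding D_def by (metis add.commute add.left_commute add_left_mono dist_commute dist_triangle dist_triangle_le order_trans)
  then have D: "D \<le> 4 * \<epsilon>"
    using half close by linarith
  have "dist x p \<le> dist x z + dist p z"
    by (rule dist_triangle2)
  then have "dist x p < 3 * \<epsilon>"
    using half D close by linarith
  moreover have "\<bar>birkhoff_sum n \<psi> p - birkhoff_sum n \<psi> z\<bar> \<le> L * D"
    using birkhoff_sum_agree[OF L, of n p z] agree per by (simp add: D_def)
  then have "\<bar>birkhoff_sum n \<psi> p - birkhoff_sum n \<psi> z\<bar> \<le> 4 * L * \<epsilon>"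
    using mult_left_mono[OF D lipschitz_on_nonneg[OF L]] by linarith
  ultimately show ?thesis
    using that per by blast
qed

section \<open>Periodic orbits have nonnegative cost\<close>

definition orbit_measure :: "nat \<Rightarrow> seqs \<Rightarrow> seqs measure" where
  "orbit_measure n p = distr (measure_pmf (pmf_of_set {..<n})) borel (\<lambda>i. (shift ^^ i) p)"

lemma orbit_measure_invariant:
  assumes n: "1 \<le> n" and per: "(shift ^^ n) p = p"
  shows "orbit_measure n p \<in> invariant_measures"
proof -
  let ?M = "measure_pmf (pmf_of_set {..<n})"
  have ne: "{..<n} \<noteq> {}" using n by (auto simp: lessThan_empty_iff)
  have em: "emeasure (orbit_measure n p) A = ennreal ((\<Sum>i<n. indicator A ((shift ^^ i) p)) / real n)"
    if "A \<in> sets borel" for A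
  proof -
    have "real (card ({..<n} \<inter> {i. (shift ^^ i) p \<in> A})) = (\<Sum>i<n. indicator A ((shift ^^ i) p))"
      by (simp add: indicator_def sum.If_cases Collect_conj_eq)
    moreover have "emeasure (orbit_measure n p) A = emeasure ?M {i. (shift ^^ i) p \<in> A}"
      using that unfolding orbit_measure_def by (subst emeasure_distr) (auto simp: vimage_def)
    ultimately show ?thesis
      using ne by (simp add: emeasure_pmf_of_set ennreal_of_nat_eq_real_of_nat divide_ennreal)
  qed
  have "emeasure (orbit_measure n p) (shift -` A) = emeasure (orbit_measure n p) A"
    if A: "A \<in> sets borel" for A
  proof -
    have "shift -` A \<in> sets borel"
      using measurable_sets[OF shift_measurable A] by simp
    \<comment> \<open>Shifting moves the points of the orbit forward by one; the two sums differ by the terms for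
      times \<open>0\<close> and \<open>n\<close>, which are equal.\<close>
    moreover have "(\<Sum>i<n. indicator (shift -` A) ((shift ^^ i) p))
        = (\<Sum>i<n. indicator A ((shift ^^ i) p) :: real)"
      using sum.lessThan_Suc_shift[of "\<lambda>i. indicator A ((shift ^^ i) p) :: real" n] per
      by (simp add: indicator_def)
    ultimately show ?thesis
      using em A by simp
  qed
  moreover have "prob_space (orbit_measure n p)"
    unfolding orbit_measure_def by (rule prob_space.prob_space_distr) (auto simp: prob_space_measure_pmf)
  ultimately show ?thesis
    by (simp add: invariant_measures_def orbit_measure_def)
qed

lemma min_value_le:
  assumes L: "L-lipschitz_on UNIV \<phi>" and \<mu>: "\<mu> \<in> invariant_measures"
  shows "min_value \<phi> \<le> (\<integral>x. \<phi> x \<partial>\<mu>)"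
proof -
  fix x0 :: seqs
  define C where "C = \<bar>\<phi> x0\<bar> + L * 2"
  have C: "\<bar>\<phi> x\<bar> \<le> C" for x
  proof -
    have "\<bar>\<phi> x - \<phi> x0\<bar> \<le> L * dist x x0"
      using lipschitz_onD[OF L] by (simp add: dist_real_def)
    also have "\<dots> \<le> L * 2"
      by (rule mult_left_mono[OF dist_seqs_le_2 lipschitz_on_nonneg[OF L]])
    finally show ?thesis by (simp add: C_def)
  qed
  have meas: "\<phi> \<in> borel_measurable borel"
    by (rule borel_measurable_continuous_onI[OF lipschitz_on_continuous_on[OF L]])
  have "- C \<le> (\<integral>x. \<phi> x \<partial>\<nu>)" if "\<nu> \<in> invariant_measures" for \<nu>
  proof -
    interpret prob_space \<nu> using that by (simp add: invariant_measures_def)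
    have "sets \<nu> = sets borel" using that by (simp add: invariant_measures_def)
    then have "\<phi> \<in> borel_measurable \<nu>" using meas by (simp cong: measurable_cong_sets)
    then have "integrable \<nu> \<phi>"
      by (intro integrable_const_bound[of _ C]) (auto simp: C)
    moreover have "- C \<le> \<phi> x" for x using C[of x] by linarith
    ultimately show ?thesis by (intro integral_ge_const) auto
  qed
  then have "bdd_below ((\<lambda>\<mu>. \<integral>x. \<phi> x \<partial>\<mu>) ` invariant_measures)"
    by (intro bdd_belowI2)
  then show ?thesis
    unfolding min_value_def using \<mu> by (rule cINF_lower)
qed

lemma birkhoff_sum_periodic_nonneg:
  assumes L: "L-lipschitz_on UNIV \<phi>" and n: "1 \<le> n" and per: "(shift ^^ n) p = p"
  shows "0 \<le> birkhoff_sum n (\<lambda>w. \<phi> w - min_value \<phi>) p"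
proof -
  have meas: "\<phi> \<in> borel_measurable borel"
    by (rule borel_measurable_continuous_onI[OF lipschitz_on_continuous_on[OF L]])
  have "min_value \<phi> \<le> (\<integral>x. \<phi> x \<partial>orbit_measure n p)"
    by (rule min_value_le[OF L orbit_measure_invariant[OF n per]])
  also have "\<dots> = (\<integral>i. \<phi> ((shift ^^ i) p) \<partial>measure_pmf (pmf_of_set {..<n}))"
    unfolding orbit_measure_def by (rule integral_distr) (auto simp: meas)
  also have "\<dots> = (\<Sum>i<n. \<phi> ((shift ^^ i) p)) / real n"
    using n by (subst integral_pmf_of_set) (auto simp: lessThan_empty_iff)
  finally show ?thesis
    using n by (simp add: birkhoff_sum_def sum_subtractf field_simps)
qed

section \<open>The Mane potential and the barrier without limits\<close>

lemma Lim_at_right_antimono_eq_SUP: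
  fixes f :: "real \<Rightarrow> ereal"
  assumes anti: "\<And>\<delta> \<epsilon>. \<delta> \<le> \<epsilon> \<Longrightarrow> f \<epsilon> \<le> f \<delta>"
  shows "Lim (at_right 0) f = (SUP \<epsilon>\<in>{0<..}. f \<epsilon>)"
proof (rule antisym)
  have lim: "(f \<longlongrightarrow> Lim (at_right 0) f) (at_right 0)"
    by (rule antimono_tendsto_Lim_at_right) (rule anti)
  show "Lim (at_right 0) f \<le> (SUP \<epsilon>\<in>{0<..}. f \<epsilon>)"
    by (rule tendsto_upperbound[OF lim])
       (auto intro!: eventually_at_right_less[THEN eventually_mono] SUP_upper)
  show "(SUP \<epsilon>\<in>{0<..}. f \<epsilon>) \<le> Lim (at_right 0) f"
  proof (rule SUP_least)
    fix e :: real assume "e \<in> {0<..}"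
    then have "\<forall>\<^sub>F \<epsilon> in at_right 0. f e \<le> f \<epsilon>"
      unfolding eventually_at_right_field using anti by (metis greaterThan_iff less_imp_le)
    then show "f e \<le> Lim (at_right 0) f"
      by (rule tendsto_lowerbound[OF lim]) simp
  qed
qed

abbreviation cost :: "(seqs \<Rightarrow> real) \<Rightarrow> nat \<Rightarrow> seqs \<Rightarrow> real" where
  "cost \<phi> n z \<equiv> birkhoff_sum n (\<lambda>w. \<phi> w - min_value \<phi>) z"

lemma mane_potential_eq_SUP:
  "mane_potential \<phi> x y =
     (SUP \<epsilon>\<in>{0<..}. Inf {ereal (cost \<phi> n z) | n z. 1 \<le> n \<and> z \<in> connecting x y n \<epsilon>})"
  unfolding mane_potential_def
  by (rule Lim_at_right_antimono_eq_SUP, rule Inf_superset_mono) (use connecting_mono in blast)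

lemma peierls_barrier_eq_SUP:
  "peierls_barrier \<phi> x y =
     (SUP \<epsilon>\<in>{0<..}. liminf (\<lambda>n. INF z\<in>connecting x y n \<epsilon>. ereal (cost \<phi> n z)))"
  unfolding peierls_barrier_def
  by (rule Lim_at_right_antimono_eq_SUP, intro Liminf_mono always_eventually allI
        INF_superset_mono connecting_mono) auto

lemma mane_potential_lessD:
  assumes "mane_potential \<phi> x y < c" and "0 < \<epsilon>"
  obtains n z where "1 \<le> n" "z \<in> connecting x y n \<epsilon>" "ereal (cost \<phi> n z) < c"
proof -
  have "Inf {ereal (cost \<phi> n z) | n z. 1 \<le> n \<and> z \<in> connecting x y n \<epsilon>} < c"
    using assms unfolding mane_potential_eq_SUP by (meson SUP_upper greaterThan_iff le_less_trans)
  then show ?thesis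
    using that unfolding Inf_less_iff by blast
qed

text \<open>The factor \<open>K\<close>, arbitrary but independent of \<open>\<epsilon>\<close>, absorbs the Lipschitz constants, so that
  segments may be built from pieces of precision \<open>\<epsilon>\<close>.\<close>

lemma mane_potential_leI:
  assumes K: "0 \<le> K"
    and seg: "\<And>\<epsilon>. 0 < \<epsilon> \<Longrightarrow> \<exists>n\<ge>1. \<exists>z\<in>connecting x y n (K * \<epsilon>). cost \<phi> n z \<le> c + K * \<epsilon>"
  shows "mane_potential \<phi> x y \<le> ereal c"
  unfolding mane_potential_eq_SUP
proof (rule SUP_least, rule ereal_le_epsilon2)
  fix e \<eta> :: real assume "e \<in> {0<..}" "0 < \<eta>"
  define \<epsilon> where "\<epsilon> = min e \<eta> / (K + 1)"
  have "0 < \<epsilon>" using \<open>e \<in> {0<..}\<close> \<open>0 < \<eta>\<close> K by (simp add: \<epsilon>_def)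
  have "K * \<epsilon> \<le> (K + 1) * \<epsilon>" using \<open>0 < \<epsilon>\<close> by (simp add: algebra_simps)
  also have "\<dots> = min e \<eta>" using K by (simp add: \<epsilon>_def)
  finally have small: "K * \<epsilon> \<le> e" "K * \<epsilon> \<le> \<eta>" by auto
  obtain n z where "1 \<le> n" "z \<in> connecting x y n (K * \<epsilon>)" and c: "cost \<phi> n z \<le> c + K * \<epsilon>"
    using seg[OF \<open>0 < \<epsilon>\<close>] by blast
  then have "Inf {ereal (cost \<phi> n z) | n z. 1 \<le> n \<and> z \<in> connecting x y n e} \<le> ereal (cost \<phi> n z)"
    using connecting_mono[OF small(1)] by (intro Inf_lower) blast
  also have "\<dots> \<le> ereal c + ereal \<eta>"
    using c small by simp
  finally show "Inf {ereal (cost \<phi> n z) | n z. 1 \<le> n \<and> z \<in> connecting x y n e} \<le> ereal c + ereal \<eta>" .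
qed

lemma mane_potential_geI:
  assumes "0 \<le> K"
    and bound: "\<And>\<epsilon> n z. 0 < \<epsilon> \<Longrightarrow> 1 \<le> n \<Longrightarrow> z \<in> connecting x y n \<epsilon> \<Longrightarrow> c - K * \<epsilon> \<le> cost \<phi> n z"
  shows "ereal c \<le> mane_potential \<phi> x y"
proof (rule ccontr)
  assume "\<not> ereal c \<le> mane_potential \<phi> x y"
  then obtain b where b: "mane_potential \<phi> x y < ereal b" "b < c"
    by (metis ereal_dense2 ereal_less(2) less_ereal.simps(1) not_le)
  define \<epsilon> where "\<epsilon> = (c - b) / (K + 1)"
  have "0 < \<epsilon>" using b assms(1) by (simp add: \<epsilon>_def)
  then obtain n z where nz: "1 \<le> n" "z \<in> connecting x y n \<epsilon>" "cost \<phi> n z < b"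
    using mane_potential_lessD[OF b(1)] by auto
  have "c - K * \<epsilon> < b" using bound[OF \<open>0 < \<epsilon>\<close> nz(1,2)] nz(3) by linarith
  moreover have "(K + 1) * \<epsilon> = c - b" using assms(1) by (simp add: \<epsilon>_def)
  ultimately show False using \<open>0 < \<epsilon>\<close> by (simp add: algebra_simps)
qed

lemma peierls_barrier_lessD:
  assumes "peierls_barrier \<phi> x y < c" and "0 < \<epsilon>"
  obtains n z where "N \<le> n" "z \<in> connecting x y n \<epsilon>" "ereal (cost \<phi> n z) < c"
proof -
  have "liminf (\<lambda>n. INF z\<in>connecting x y n \<epsilon>. ereal (cost \<phi> n z)) < c"
    using assms unfolding peierls_barrier_eq_SUP by (meson SUP_upper greaterThan_iff le_less_trans)
  then have "\<not> (\<forall>\<^sub>F n in sequentially. c \<le> (INF z\<in>connecting x y n \<epsilon>. ereal (cost \<phi> n z)))"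
    using Liminf_bounded[of c "\<lambda>n. INF z\<in>connecting x y n \<epsilon>. ereal (cost \<phi> n z)" sequentially]
    by auto
  then obtain n where "N \<le> n" "(INF z\<in>connecting x y n \<epsilon>. ereal (cost \<phi> n z)) < c"
    unfolding eventually_sequentially by (meson not_le)
  then show ?thesis
    using that unfolding INF_less_iff by blast
qed

lemma peierls_barrier_leI:
  assumes seg: "\<And>\<epsilon> N. 0 < \<epsilon> \<Longrightarrow> \<exists>n\<ge>N. \<exists>z\<in>connecting x y n \<epsilon>. cost \<phi> n z \<le> c + \<epsilon>"
  shows "peierls_barrier \<phi> x y \<le> ereal c"
  unfolding peierls_barrier_eq_SUP
proof (rule SUP_least, rule ereal_le_epsilon2)
  fix e \<eta> :: real assume pos: "e \<in> {0<..}" "0 < \<eta>"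
  let ?I = "\<lambda>n. INF z\<in>connecting x y n e. ereal (cost \<phi> n z)"
  have "\<exists>n\<ge>N. ?I n \<le> ereal c + ereal \<eta>" for N
  proof -
    obtain n z where n: "N \<le> n" and z: "z \<in> connecting x y n (min e \<eta>)"
        and c: "cost \<phi> n z \<le> c + min e \<eta>"
      using seg[of "min e \<eta>" N] pos by auto
    have "?I n \<le> ereal (cost \<phi> n z)"
      using z connecting_mono[of "min e \<eta>" e] by (intro INF_lower) auto
    also have "\<dots> \<le> ereal c + ereal \<eta>" using c by simp
    finally show ?thesis using n by blast
  qed
  then have "\<not> (\<forall>\<^sub>F n in sequentially. ereal c + ereal \<eta> < ?I n)"
    unfolding eventually_sequentially by (meson not_le)
  then show "liminf ?I \<le> ereal c + ereal \<eta>"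
    using less_LiminfD[of "ereal c + ereal \<eta>" sequentially ?I] by (meson not_le)
qed

lemma mane_potential_le_peierls_barrier: "mane_potential \<phi> x y \<le> peierls_barrier \<phi> x y"
  unfolding mane_potential_eq_SUP peierls_barrier_eq_SUP
proof (intro SUP_mono' Liminf_bounded)
  fix \<epsilon> :: real
  show "\<forall>\<^sub>F n in sequentially.
      Inf {ereal (cost \<phi> n z) | n z. 1 \<le> n \<and> z \<in> connecting x y n \<epsilon>}
        \<le> (INF z\<in>connecting x y n \<epsilon>. ereal (cost \<phi> n z))"
    using eventually_ge_at_top[of 1]
    by eventually_elim (rule INF_greatest, rule Inf_lower, auto)
qed

section \<open>Almost-loops\<close>

lemma cost_almost_loop_ge:
  assumes L: "L-lipschitz_on UNIV \<phi>" and n: "1 \<le> n" and z: "z \<in> connecting x x n \<epsilon>"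
  shows "- (4 * L * \<epsilon>) \<le> cost \<phi> n z"
proof -
  have L': "L-lipschitz_on UNIV (\<lambda>w. \<phi> w - min_value \<phi>)"
    using L by (auto simp: lipschitz_on_def dist_real_def)
  obtain p where p: "(shift ^^ n) p = p" "\<bar>cost \<phi> n p - cost \<phi> n z\<bar> \<le> 4 * L * \<epsilon>"
    using closing[OF L' n z] by blast
  then show ?thesis
    using birkhoff_sum_periodic_nonneg[OF L n p(1)] by linarith
qed

lemma mane_potential_diag_nonneg:
  assumes L: "L-lipschitz_on UNIV \<phi>"
  shows "0 \<le> mane_potential \<phi> x x"
  using mane_potential_geI[of "4 * L" x x 0 \<phi>] cost_almost_loop_ge[OF L] lipschitz_on_nonneg[OF L]
  by (simp add: zero_ereal_def)

lemma cost_prepend: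
  assumes L: "L-lipschitz_on UNIV \<phi>" and z: "z \<in> connecting ((shift ^^ m) x) y n \<epsilon>"
  shows "prepend m x z \<in> connecting x y (m + n) \<epsilon>"
    and "\<bar>cost \<phi> (m + n) (prepend m x z) - (cost \<phi> m x + cost \<phi> n z)\<bar> \<le> L * \<epsilon>"
proof -
  have L': "L-lipschitz_on UNIV (\<lambda>w. \<phi> w - min_value \<phi>)"
    using L by (auto simp: lipschitz_on_def dist_real_def)
  let ?w = "prepend m x z"
  have agree: "coord x i = coord ?w i" if "i < m" for i
    using that by (simp add: coord_prepend)
  have d: "dist ((shift ^^ m) x) z < \<epsilon>" "dist ((shift ^^ n) z) y < \<epsilon>"
    using z by (auto simp: connecting_def)
  have "dist x ?w = dist ((shift ^^ m) x) z / 2 ^ m"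
    using dist_agree[of m x ?w] agree by (simp add: shift_prepend)
  also have "\<dots> \<le> dist ((shift ^^ m) x) z"
    by (simp add: divide_le_eq mult_right_le_one_le mult_le_cancel_left1)
  finally have "dist x ?w < \<epsilon>" using d by linarith
  moreover have "(shift ^^ (m + n)) ?w = (shift ^^ n) z"
    by (simp add: add.commute[of m] funpow_add shift_prepend)
  ultimately show "?w \<in> connecting x y (m + n) \<epsilon>"
    using d by (simp add: connecting_def)
  have "\<bar>cost \<phi> m x - cost \<phi> m ?w\<bar> \<le> L * dist ((shift ^^ m) x) z"
    using birkhoff_sum_agree[OF L', of m x ?w] agree by (simp add: shift_prepend)
  also have "\<dots> \<le> L * \<epsilon>"
    using d lipschitz_on_nonneg[OF L] by (intro mult_left_mono) auto
  finally show "\<bar>cost \<phi> (m + n) ?w - (cost \<phi> m x + cost \<phi> n z)\<bar> \<le> L * \<epsilon>"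
    by (simp add: birkhoff_sum_add shift_prepend abs_minus_commute)
qed

text \<open>A segment from near \<open>\<sigma>\<^sup>m x\<close> to near \<open>x\<close> becomes an almost-loop at \<open>x\<close> when the first \<open>m\<close>
  coordinates of \<open>x\<close> are put in front of it, and almost-loops cost essentially at least \<open>0\<close>.\<close>

lemma mane_potential_return_ge:
  assumes L: "L-lipschitz_on UNIV \<phi>"
  shows "ereal (- cost \<phi> m x) \<le> mane_potential \<phi> ((shift ^^ m) x) x"
proof (rule mane_potential_geI[of "5 * L"])
  fix \<epsilon> :: real and n z assume "1 \<le> n" and z: "z \<in> connecting ((shift ^^ m) x) x n \<epsilon>"
  then have "1 \<le> m + n" by simp
  from cost_almost_loop_ge[OF L this cost_prepend(1)[OF L z]]
  show "- cost \<phi> m x - 5 * L * \<epsilon> \<le> cost \<phi> n z"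
    using cost_prepend(2)[OF L z] by linarith
qed (use lipschitz_on_nonneg[OF L] in simp)

section \<open>The three sets coincide\<close>

lemma peierls_barrier_zero_if_mane_potential_zero:
  assumes L: "L-lipschitz_on UNIV \<phi>" and zero: "mane_potential \<phi> x x = 0"
  shows "peierls_barrier \<phi> x x = 0"
proof (rule antisym)
  have L': "L-lipschitz_on UNIV (\<lambda>w. \<phi> w - min_value \<phi>)"
    using L by (auto simp: lipschitz_on_def dist_real_def)
  have L0: "0 \<le> L" by (rule lipschitz_on_nonneg[OF L])
  have "peierls_barrier \<phi> x x \<le> ereal 0"
  proof (rule peierls_barrier_leI)
    fix \<epsilon> :: real and N :: nat assume \<epsilon>: "0 < \<epsilon>"
    define M where "M = real (Suc N) * (4 * L + 3)"
    \<comment> \<open>The closed-up loop costs at most \<open>(4 * L + 1) * \<delta>\<close> and stays within \<open>3 * \<delta>\<close> of \<open>x\<close>; the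
      number of repetitions is known before \<open>\<delta>\<close> has to be chosen.\<close>
    define \<delta> where "\<delta> = \<epsilon> / M"
    have M: "0 < M" "3 \<le> M"
    proof -
      have "1 * 3 \<le> M" unfolding M_def using L0 by (intro mult_mono) auto
      then show "3 \<le> M" "0 < M" by auto
    qed
    have \<delta>: "0 < \<delta>" "M * \<delta> = \<epsilon>" using M \<epsilon> by (auto simp: \<delta>_def)
    obtain n z where n: "1 \<le> n" and z: "z \<in> connecting x x n \<delta>" and c: "cost \<phi> n z < \<delta>"
      using mane_potential_lessD[of \<phi> x x "ereal \<delta>" \<delta>] zero \<delta> by auto
    obtain p where per: "(shift ^^ n) p = p" and xp: "dist x p < 3 * \<delta>"
      and cp: "\<bar>cost \<phi> n p - cost \<phi> n z\<bar> \<le> 4 * L * \<delta>"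
      using closing[OF L' n z] by blast
    have "3 * \<delta> \<le> \<epsilon>" using mult_right_mono[OF M(2), of \<delta>] \<delta> by simp
    then have "p \<in> connecting x x (Suc N * n) \<epsilon>"
      using birkhoff_sum_periodic[OF per, of "Suc N"] xp
      by (simp add: connecting_def dist_commute del: mult_Suc)
    moreover have "cost \<phi> n p \<le> (4 * L + 3) * \<delta>"
      using cp c \<delta> by (simp add: algebra_simps)
    then have "real (Suc N) * cost \<phi> n p \<le> real (Suc N) * ((4 * L + 3) * \<delta>)"
      by (intro mult_left_mono) auto
    then have "cost \<phi> (Suc N * n) p \<le> 0 + \<epsilon>"
      using birkhoff_sum_periodic[OF per, of "Suc N"] \<delta>(2)
      unfolding M_def mult.assoc by (metis add_0)
    moreover have "N \<le> Suc N * n" using n by (cases n) auto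
    ultimately show "\<exists>n\<ge>N. \<exists>z\<in>connecting x x n \<epsilon>. cost \<phi> n z \<le> 0 + \<epsilon>" by blast
  qed
  then show "peierls_barrier \<phi> x x \<le> 0" by (simp add: zero_ereal_def)
  show "0 \<le> peierls_barrier \<phi> x x"
    using mane_potential_le_peierls_barrier[of \<phi> x x] zero by simp
qed

text \<open>Let \<open>z\<close> be a cheap almost-loop at \<open>x\<close> of length \<open>n > j\<close>. The segment starting at \<open>\<sigma>\<^sup>j z\<close> of
  length \<open>n - j + i\<close> leads from near \<open>\<sigma>\<^sup>j x\<close> to near \<open>\<sigma>\<^sup>i x\<close>, and costs
  \<open>S\<^sub>n z - S\<^sub>j z + S\<^sub>i (\<sigma>\<^sup>n z)\<close>, which is close to \<open>0 - S\<^sub>j x + S\<^sub>i x = - S\<^bsub>j - i\<^esub> (\<sigma>\<^sup>i x)\<close>. The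
  vanishing of the barrier is what makes \<open>n > j\<close> possible.\<close>

lemma mane_potential_return_le:
  assumes L: "L-lipschitz_on UNIV \<phi>" and zero: "peierls_barrier \<phi> x x = 0" and "i < j"
  shows "mane_potential \<phi> ((shift ^^ j) x) ((shift ^^ i) x)
    \<le> ereal (- cost \<phi> (j - i) ((shift ^^ i) x))"
proof -
  have L': "L-lipschitz_on UNIV (\<lambda>w. \<phi> w - min_value \<phi>)"
    using L by (auto simp: lipschitz_on_def dist_real_def)
  have L0: "0 \<le> L" by (rule lipschitz_on_nonneg[OF L])
  \<comment> \<open>Large enough for the distances at both ends, which grow under the shift by up to \<open>2 ^ j\<close> and
    \<open>2 ^ i\<close>, and for the error \<open>1 + L * 2 ^ i + L * 2 ^ j\<close> in the cost, all in units of \<open>\<epsilon>\<close>.\<close>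
  define K where "K = (1 + L) * (2 ^ i + 2 ^ j)"
  have one: "(1 :: real) \<le> 2 ^ i" "(1 :: real) \<le> 2 ^ j" by simp_all
  have K: "K = 2 ^ i + 2 ^ j + (L * 2 ^ i + L * 2 ^ j)" by (simp add: K_def algebra_simps)
  have K': "0 \<le> L * 2 ^ i" "0 \<le> L * 2 ^ j" using L0 by auto
  show ?thesis
  proof (rule mane_potential_leI[of K])
    show "0 \<le> K" using L0 by (simp add: K_def)
    fix \<epsilon> :: real assume \<epsilon>: "0 < \<epsilon>"
    obtain n z where n: "Suc j \<le> n" and z: "z \<in> connecting x x n \<epsilon>" and c: "cost \<phi> n z < \<epsilon>"
      using peierls_barrier_lessD[of \<phi> x x "ereal \<epsilon>" \<epsilon>] zero \<epsilon> by auto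
    have d: "dist x z < \<epsilon>" "dist ((shift ^^ n) z) x < \<epsilon>"
      using z by (auto simp: connecting_def)
    let ?z = "(shift ^^ j) z" and ?n = "n - j + i"
    have step: "(shift ^^ k) ((shift ^^ l) z) = (shift ^^ (k + l)) z" for k l
      by (simp add: funpow_add)
    have "dist ((shift ^^ j) x) ?z \<le> 2 ^ j * dist x z"
      by (rule dist_shift_funpow_le)
    also have "\<dots> < 2 ^ j * \<epsilon>" using d by simp
    also have "\<dots> \<le> K * \<epsilon>" using K K' by (intro mult_right_mono) (use one \<epsilon> in linarith)+
    finally have near_start: "dist ((shift ^^ j) x) ?z < K * \<epsilon>" .
    have "dist ((shift ^^ i) ((shift ^^ n) z)) ((shift ^^ i) x) \<le> 2 ^ i * dist ((shift ^^ n) z) x"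
      by (rule dist_shift_funpow_le)
    also have "\<dots> < 2 ^ i * \<epsilon>" using d by simp
    also have "\<dots> \<le> K * \<epsilon>" using K K' by (intro mult_right_mono) (use one \<epsilon> in linarith)+
    finally have "dist ((shift ^^ ?n) ?z) ((shift ^^ i) x) < K * \<epsilon>"
      using n by (simp add: step add.commute)
    with near_start have "?z \<in> connecting ((shift ^^ j) x) ((shift ^^ i) x) ?n (K * \<epsilon>)"
      by (simp add: connecting_def)
    moreover have "cost \<phi> ?n ?z \<le> - cost \<phi> (j - i) ((shift ^^ i) x) + K * \<epsilon>"
    proof -
      have "cost \<phi> j z + cost \<phi> ?n ?z = cost \<phi> n z + cost \<phi> i ((shift ^^ n) z)"
        using birkhoff_sum_add[of j ?n _ z] birkhoff_sum_add[of n i _ z] n by simp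
      moreover have "cost \<phi> j x = cost \<phi> i x + cost \<phi> (j - i) ((shift ^^ i) x)"
        using birkhoff_sum_add[of i "j - i" _ x] \<open>i < j\<close> by simp
      moreover have "\<bar>cost \<phi> j x - cost \<phi> j z\<bar> \<le> L * 2 ^ j * \<epsilon>"
        using birkhoff_sum_lipschitz[OF L', of j x z] mult_left_mono[OF less_imp_le[OF d(1)] K'(2)]
        by linarith
      moreover have "\<bar>cost \<phi> i ((shift ^^ n) z) - cost \<phi> i x\<bar> \<le> L * 2 ^ i * \<epsilon>"
        using birkhoff_sum_lipschitz[OF L', of i "(shift ^^ n) z" x]
          mult_left_mono[OF less_imp_le[OF d(2)] K'(1)]
        by linarith
      moreover have "\<epsilon> + L * 2 ^ j * \<epsilon> + L * 2 ^ i * \<epsilon> = (1 + L * 2 ^ j + L * 2 ^ i) * \<epsilon>"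
        by (simp add: algebra_simps)
      moreover have "(1 + L * 2 ^ j + L * 2 ^ i) * \<epsilon> \<le> K * \<epsilon>"
        using K one \<epsilon> by (intro mult_right_mono) linarith+
      ultimately show ?thesis using c by linarith
    qed
    moreover have "1 \<le> ?n" using n by simp
    ultimately show "\<exists>n\<ge>1. \<exists>z\<in>connecting ((shift ^^ j) x) ((shift ^^ i) x) n (K * \<epsilon>).
        cost \<phi> n z \<le> - cost \<phi> (j - i) ((shift ^^ i) x) + K * \<epsilon>" by blast
  qed
qed

text \<open>The sum along the orbit is finite, so the negation can be moved to the side of the reals.\<close>

lemma static_orbit_iff:
  "static_orbit \<phi> x \<longleftrightarrow>
    (\<forall>i j. i < j \<longrightarrow> mane_potential \<phi> ((shift ^^ j) x) ((shift ^^ i) x)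
      = ereal (- cost \<phi> (j - i) ((shift ^^ i) x)))"
proof -
  have "(\<Sum>n = i..<j. \<phi> ((shift ^^ n) x) - min_value \<phi>) = cost \<phi> (j - i) ((shift ^^ i) x)"
    if "i < j" for i j
    using sum.shift_bounds_nat_ivl[of "\<lambda>n. \<phi> ((shift ^^ n) x) - min_value \<phi>" 0 i "j - i"] that
    by (simp add: birkhoff_sum_def atLeast0LessThan funpow_add)
  moreover have "ereal a = - b \<longleftrightarrow> b = ereal (- a)" for a b
    by (cases b) auto
  ultimately show ?thesis
    unfolding static_orbit_def by simp
qed

lemma static_orbit_if_peierls_barrier_zero:
  assumes L: "L-lipschitz_on UNIV \<phi>" and "peierls_barrier \<phi> x x = 0"
  shows "static_orbit \<phi> x"
  unfolding static_orbit_iff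
proof (intro allI impI antisym)
  fix i j :: nat assume "i < j"
  then show "mane_potential \<phi> ((shift ^^ j) x) ((shift ^^ i) x)
      \<le> ereal (- cost \<phi> (j - i) ((shift ^^ i) x))"
    by (rule mane_potential_return_le[OF assms])
  have "(shift ^^ (j - i)) ((shift ^^ i) x) = (shift ^^ j) x"
    using \<open>i < j\<close> by (metis comp_apply funpow_add le_add_diff_inverse2 less_imp_le)
  then show "ereal (- cost \<phi> (j - i) ((shift ^^ i) x))
      \<le> mane_potential \<phi> ((shift ^^ j) x) ((shift ^^ i) x)"
    using mane_potential_return_ge[OF L, of "j - i" "(shift ^^ i) x"] by simp
qed

text \<open>For \<open>x\<close> on a static orbit, the cheapest way back from \<open>\<sigma> x\<close> to \<open>x\<close> exactly cancels the cost
  of the step from \<open>x\<close> to \<open>\<sigma> x\<close>; together they form an almost-loop.\<close>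

lemma mane_potential_zero_on_static_orbit:
  assumes L: "L-lipschitz_on UNIV \<phi>" and stat: "static_orbit \<phi> y"
  shows "mane_potential \<phi> ((shift ^^ k) y) ((shift ^^ k) y) = 0"
proof (rule antisym)
  define x where "x = (shift ^^ k) y"
  have L0: "0 \<le> L" by (rule lipschitz_on_nonneg[OF L])
  have return: "mane_potential \<phi> ((shift ^^ 1) x) x = ereal (- cost \<phi> 1 x)"
    using stat[unfolded static_orbit_iff, rule_format, of k "Suc k"] by (simp add: x_def)
  have "mane_potential \<phi> x x \<le> ereal 0"
  proof (rule mane_potential_leI[of "1 + L"])
    fix \<epsilon> :: real assume \<epsilon>: "0 < \<epsilon>"
    have "mane_potential \<phi> ((shift ^^ 1) x) x < ereal (- cost \<phi> 1 x + \<epsilon>)"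
      unfolding return using \<epsilon> by simp
    then obtain n z where z: "z \<in> connecting ((shift ^^ 1) x) x n \<epsilon>"
        and c: "cost \<phi> n z < - cost \<phi> 1 x + \<epsilon>"
      using mane_potential_lessD[OF _ \<epsilon>] by (metis less_ereal.simps(1))
    have "\<epsilon> \<le> (1 + L) * \<epsilon>" using L0 \<epsilon> by (simp add: algebra_simps)
    then have "prepend 1 x z \<in> connecting x x (1 + n) ((1 + L) * \<epsilon>)"
      using cost_prepend(1)[OF L z] connecting_mono by blast
    moreover have "cost \<phi> (1 + n) (prepend 1 x z) \<le> 0 + (1 + L) * \<epsilon>"
      using cost_prepend(2)[OF L z] c unfolding distrib_right by linarith
    ultimately show "\<exists>n\<ge>1. \<exists>z\<in>connecting x x n ((1 + L) * \<epsilon>). cost \<phi> n z \<le> 0 + (1 + L) * \<epsilon>"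
      using le_add1 by blast
  qed (use L0 in simp)
  then show "mane_potential \<phi> ((shift ^^ k) y) ((shift ^^ k) y) \<le> 0"
    by (simp add: x_def zero_ereal_def)
  show "0 \<le> mane_potential \<phi> ((shift ^^ k) y) ((shift ^^ k) y)"
    by (rule mane_potential_diag_nonneg[OF L])
qed

theorem theorem1:
  fixes \<phi> :: "seqs \<Rightarrow> real" and H_diag :: "seqs \<Rightarrow> ereal"
  assumes "\<exists>L. L-lipschitz_on UNIV \<phi>"
  defines "H_diag \<equiv> (\<lambda>x. peierls_barrier \<phi> x x)"
  shows "aubry_set \<phi> = H_diag -` {0} \<and> H_diag -` {0} = static_set \<phi>"
proof -
  obtain L where L: "L-lipschitz_on UNIV \<phi>" using assms(1) by blast
  have "aubry_set \<phi> \<subseteq> H_diag -` {0}"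
    using peierls_barrier_zero_if_mane_potential_zero[OF L] by (auto simp: aubry_set_def H_diag_def)
  moreover have "H_diag -` {0} \<subseteq> static_set \<phi>"
  proof
    fix x assume "x \<in> H_diag -` {0}"
    then have "static_orbit \<phi> x"
      using static_orbit_if_peierls_barrier_zero[OF L] by (simp add: H_diag_def)
    moreover have "x = (shift ^^ 0) x" by simp
    ultimately show "x \<in> static_set \<phi>" unfolding static_set_def by blast
  qed
  moreover have "static_set \<phi> \<subseteq> aubry_set \<phi>"
    using mane_potential_zero_on_static_orbit[OF L] by (auto simp: static_set_def aubry_set_def)
  ultimately show ?thesis by blast
qed

end
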